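(* Let $n\ge 2$, let $P_n$ be the path graph on $n$ vertices, and let $m$ be a vertex, $1\le m\le n$. Set $t:=\sharp\{s : 1\le s\le n,\ (n+1)\mid sm\}=\left\lfloor\frac{n\gcd(m,n+1)}{n+1}\right\rfloor$. Then, as $\mathbb{C}$-algebras, $\mathcal{T}_1(P_n,m)\cong M_{n-t}(\mathbb{C})\oplus\bigoplus_{i=1}^t\mathbb{C}$. In particular, $\dim\mathcal{T}_1(P_n,m)=(n-t)^2+t$.
   Context: $P_n$ has vertex set $X=\{1,2,\dots,n\}$ and edge set $\{\{i,j\}: |i-j|=1\}$; let $A$ be its adjacency matrix, in the algebra $M_X(\mathbb{C})$ of complex matrices with rows and columns indexed by $X$. $E_m\in M_X(\mathbb{C})$ is the matrix with $(m,m)$-entry $1$ and all other entries $0$. $\mathcal{T}_1(P_n,m)=\mathbb{C}\langle A,E_m\rangle$ is the unital $\mathbb{C}$-subalgebra of $M_X(\mathbb{C})$ generated by $A$ and $E_m$. *)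

theory Defs
  imports
    Complex_Main
    "HOL-Algebra.QuotRing"
    "Jordan_Normal_Form.VS_Connect"
begin

text \<open>
  A (not necessarily commutative) algebra over \<open>K\<close> is represented by a record of type
  \<open>module\<close>, whose fields already comprise a ring structure and a scalar multiplication. The
  library's locale \<open>algebra\<close> is not used because it is restricted to commutative algebras.
\<close>

definition unital_subalgebra ::
    "('k, 'c) ring_scheme \<Rightarrow> ('k, 'a, 'd) module_scheme \<Rightarrow> 'a set \<Rightarrow> bool" where
  "unital_subalgebra K A S \<longleftrightarrow>
     S \<subseteq> carrier A \<and> \<zero>\<^bsub>A\<^esub> \<in> S \<and> \<one>\<^bsub>A\<^esub> \<in> S \<and>
     (\<forall>x\<in>S. \<forall>y\<in>S. x \<oplus>\<^bsub>A\<^esub> y \<in> S) \<and>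
     (\<forall>x\<in>S. \<forall>y\<in>S. x \<otimes>\<^bsub>A\<^esub> y \<in> S) \<and>
     (\<forall>c\<in>carrier K. \<forall>x\<in>S. c \<odot>\<^bsub>A\<^esub> x \<in> S)"

definition generated_subalgebra ::
    "('k, 'c) ring_scheme \<Rightarrow> ('k, 'a, 'd) module_scheme \<Rightarrow> 'a set \<Rightarrow> ('k, 'a, 'd) module_scheme" where
  "generated_subalgebra K A X = A\<lparr>carrier := \<Inter>{S. unital_subalgebra K A S \<and> X \<subseteq> S}\<rparr>"

definition algebra_iso ::
    "('k, 'c) ring_scheme \<Rightarrow> ('k, 'a, 'd) module_scheme \<Rightarrow> ('k, 'b, 'e) module_scheme \<Rightarrow> ('a \<Rightarrow> 'b) set" where
  "algebra_iso K A B =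
     {h \<in> ring_iso A B. \<forall>c\<in>carrier K. \<forall>x\<in>carrier A. h (c \<odot>\<^bsub>A\<^esub> x) = c \<odot>\<^bsub>B\<^esub> h x}"

definition algebra_isomorphic ::
    "('k, 'c) ring_scheme \<Rightarrow> ('k, 'a, 'd) module_scheme \<Rightarrow> ('k, 'b, 'e) module_scheme \<Rightarrow> bool" where
  "algebra_isomorphic K A B \<longleftrightarrow> algebra_iso K A B \<noteq> {}"

text \<open>
  The library's \<open>direct_sum\<close> of modules equips the sum with the zero multiplication, so the
  componentwise algebra structure is introduced here.
\<close>

definition algebra_sum ::
    "('k, 'a, 'd) module_scheme \<Rightarrow> ('k, 'b, 'e) module_scheme \<Rightarrow> ('k, 'a \<times> 'b) module" where
  "algebra_sum A B =
     \<lparr>carrier = carrier A \<times> carrier B,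
      mult = (\<lambda>x y. (fst x \<otimes>\<^bsub>A\<^esub> fst y, snd x \<otimes>\<^bsub>B\<^esub> snd y)),
      one = (\<one>\<^bsub>A\<^esub>, \<one>\<^bsub>B\<^esub>),
      zero = (\<zero>\<^bsub>A\<^esub>, \<zero>\<^bsub>B\<^esub>),
      add = (\<lambda>x y. (fst x \<oplus>\<^bsub>A\<^esub> fst y, snd x \<oplus>\<^bsub>B\<^esub> snd y)),
      smult = (\<lambda>c x. (c \<odot>\<^bsub>A\<^esub> fst x, c \<odot>\<^bsub>B\<^esub> snd x))\<rparr>"

text \<open>The following is the direct sum only for a finite index set \<open>I\<close>; otherwise it is the product.\<close>

definition algebra_Sum ::
    "'i set \<Rightarrow> ('i \<Rightarrow> ('k, 'a, 'd) module_scheme) \<Rightarrow> ('k, 'i \<Rightarrow> 'a) module" where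
  "algebra_Sum I A =
     \<lparr>carrier = (\<Pi>\<^sub>E i\<in>I. carrier (A i)),
      mult = (\<lambda>x y. \<lambda>i\<in>I. x i \<otimes>\<^bsub>A i\<^esub> y i),
      one = (\<lambda>i\<in>I. \<one>\<^bsub>A i\<^esub>),
      zero = (\<lambda>i\<in>I. \<zero>\<^bsub>A i\<^esub>),
      add = (\<lambda>x y. \<lambda>i\<in>I. x i \<oplus>\<^bsub>A i\<^esub> y i),
      smult = (\<lambda>c x. \<lambda>i\<in>I. c \<odot>\<^bsub>A i\<^esub> x i)\<rparr>"

abbreviation complex_field :: "complex ring" where
  "complex_field \<equiv> class_ring"

definition complex_algebra :: "(complex, complex) module" where
  "complex_algebra =
     \<lparr>carrier = UNIV, mult = (*), one = 1, zero = 0, add = (+), smult = (*)\<rparr>"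

abbreviation matrix_algebra :: "nat \<Rightarrow> (complex, complex mat) module" where
  "matrix_algebra n \<equiv> module_mat TYPE(complex) n n"

definition path_edges :: "nat \<Rightarrow> nat set set" where
  "path_edges n = {{i, j} | i j. i \<in> {1..n} \<and> j \<in> {1..n} \<and> \<bar>int i - int j\<bar> = 1}"

text \<open>
  Vertices are \<open>1, \<dots>, n\<close>, whereas matrix indices start at \<open>0\<close>: index \<open>i\<close> belongs to vertex \<open>i + 1\<close>.
\<close>

definition path_adjacency :: "nat \<Rightarrow> complex mat" where
  "path_adjacency n = mat n n (\<lambda>(i, j). if {i + 1, j + 1} \<in> path_edges n then 1 else 0)"

definition diagonal_unit :: "nat \<Rightarrow> nat \<Rightarrow> complex mat" where
  "diagonal_unit n m = mat n n (\<lambda>(i, j). if i + 1 = m \<and> j + 1 = m then 1 else 0)"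

definition path_algebra_T1 :: "nat \<Rightarrow> nat \<Rightarrow> (complex, complex mat) module" where
  "path_algebra_T1 n m =
     generated_subalgebra complex_field (matrix_algebra n) {path_adjacency n, diagonal_unit n m}"

lemma unital_subalgebra_path_algebra_T1:
  "unital_subalgebra complex_field (matrix_algebra n) (carrier (path_algebra_T1 n m))"
proof -
  have "unital_subalgebra complex_field (matrix_algebra n) (carrier_mat n n)"
    by (simp add: unital_subalgebra_def module_mat_simps)
  then have "carrier_mat n n \<in> {S. unital_subalgebra complex_field (matrix_algebra n) S \<and>
      {path_adjacency n, diagonal_unit n m} \<subseteq> S}"
    by (simp add: path_adjacency_def diagonal_unit_def)
  then have "carrier (path_algebra_T1 n m) \<subseteq> carrier_mat n n"
    unfolding path_algebra_T1_def generated_subalgebra_def by auto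
  then show ?thesis
    unfolding path_algebra_T1_def generated_subalgebra_def
    by (auto simp: unital_subalgebra_def module_mat_simps)
qed

lemma vectorspace_path_algebra_T1: "vectorspace complex_field (path_algebra_T1 n m)"
proof -
  interpret V: vectorspace complex_field "matrix_algebra n"
    by (rule matrix_vs)
  let ?T = "carrier (path_algebra_T1 n m)"
  have "LinearCombinations.submodule complex_field ?T (matrix_algebra n)"
    using unital_subalgebra_path_algebra_T1[of n m] V.module_axioms
    by (auto simp: LinearCombinations.submodule_def unital_subalgebra_def)
  then have "VectorSpace.subspace complex_field ?T (matrix_algebra n)"
    by (simp add: VectorSpace.subspace_def V.vectorspace_axioms)
  then have "vectorspace complex_field ((matrix_algebra n)\<lparr>carrier := ?T\<rparr>)"
    by (rule V.subspace_is_vs)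
  then show ?thesis
    by (simp add: path_algebra_T1_def generated_subalgebra_def)
qed

end

theory Submission
  imports Defs
begin

text \<open>
  The matrix \<open>U\<close> with entries \<open>sqrt (2 / (n + 1)) * sin (i j \<pi> / (n + 1))\<close> satisfies \<open>U\<^sup>2 = 1\<close>, and its
  columns are the eigenvectors of the path. Conjugation by \<open>U\<close> turns the adjacency matrix into a
  diagonal matrix with distinct entries and \<open>E\<^sub>m\<close> into the rank-one matrix \<open>w w\<^sup>T\<close>, where \<open>w\<close> is the
  \<open>m\<close>-th column of \<open>U\<close>. Interpolation produces all diagonal matrix units, and cutting \<open>w w\<^sup>T\<close> down by
  them produces the units \<open>E\<^sub>s\<^sub>r\<close> with \<open>w\<^sub>s, w\<^sub>r \<noteq> 0\<close>. Hence the conjugated algebra is the full matrix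
  algebra on the support of \<open>w\<close> plus the diagonal matrices on its zeros, and \<open>w\<^sub>s = 0\<close> iff \<open>(n + 1) | s m\<close>.
\<close>

subsection \<open>The eigenbasis of the path\<close>

text \<open>Multiplied by \<open>2 * sin x\<close>, the sum telescopes, since 2 sin x cos(2kx) =
  sin((2k+1)x) - sin((2k-1)x). The second hypothesis then reduces sin(2Mx - x) to -cos(2Mx) sin x,
  and the first allows sin x to be cancelled.\<close>

lemma sum_cos_multiples:
  fixes x :: real
  assumes "sin x \<noteq> 0" and "sin (2 * real M * x) = 0"
  shows "(\<Sum>k<M. cos (2 * real k * x)) = (1 - cos (2 * real M * x)) / 2"
proof -
  have "2 * sin x * (\<Sum>k<K. cos (2 * real k * x)) = sin (2 * real K * x - x) + sin x" for K
  proof (induction K)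
    case (Suc K)
    have "sin (2 * real (Suc K) * x - x) = sin (2 * real K * x + x)"
      by (simp add: algebra_simps)
    then show ?case
      using Suc by (simp add: distrib_left sin_add sin_diff)
  qed simp
  from this[of M] have "sin x * (2 * (\<Sum>k<M. cos (2 * real k * x))) = sin x * (1 - cos (2 * real M * x))"
    using assms(2) by (simp add: sin_diff algebra_simps)
  then have "2 * (\<Sum>k<M. cos (2 * real k * x)) = 1 - cos (2 * real M * x)"
    using assms(1) mult_cancel_left by blast
  then show ?thesis
    by simp
qed

text \<open>Product-to-sum turns this into half the difference of two cosine sums, with frequencies
  a - b and a + b. These have the same parity, so by the closed form the two sums agree and cancel
  when a and b differ. For a = b the first sum is n + 1 and the second is 0.\<close>

lemma sum_sin_mult_sin:
  fixes n a b :: nat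
  assumes a: "1 \<le> a" "a \<le> n" and b: "1 \<le> b" "b \<le> n"
  shows "(\<Sum>k<n. sin (real (a * (k + 1)) * pi / (real n + 1)) * sin (real ((k + 1) * b) * pi / (real n + 1)))
    = (if a = b then (real n + 1) / 2 else 0)"
proof -
  \<comment> \<open>The angle is chosen so that \<open>2 * (n + 1)\<close> times it is
    \<open>d * pi\<close>, whose sine vanishes for integer \<open>d\<close>. The range has n + 1
    terms for this reason.\<close>
  define S where "S d = (\<Sum>k<Suc n. cos (2 * real k * (d * pi / (2 * (real n + 1)))))" for d :: real
  have S: "S d = (1 - cos (d * pi)) / 2"
    if "sin (d * pi) = 0" and "sin (d * pi / (2 * (real n + 1))) \<noteq> 0" for d
  proof -
    have "2 * real (Suc n) * (d * pi / (2 * (real n + 1))) = d * pi"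
      by (simp add: field_simps)
    then show ?thesis
      using sum_cos_multiples[of "d * pi / (2 * (real n + 1))" "Suc n"] that
      unfolding S_def by simp
  qed
  have sinpi: "sin (real k * pi) = 0" for k
    by (simp add: sin_npi)
  have sin_diff0: "sin ((real a - real b) * pi) = 0" "sin ((real a + real b) * pi) = 0"
    by (simp_all add: sinpi sin_diff sin_add left_diff_distrib distrib_right)
  have cos_eq: "cos ((real a + real b) * pi) = cos ((real a - real b) * pi)"
    by (simp add: sinpi cos_diff cos_add left_diff_distrib distrib_right)
  have "0 < (real a + real b) * pi / (2 * (real n + 1))"
    using a by simp
  moreover have "(real a + real b) * pi / (2 * (real n + 1)) < pi"
  proof -
    have "(real a + real b) * pi < (2 * (real n + 1)) * pi"
      using a b by (intro mult_strict_right_mono) auto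
    then show ?thesis
      by (simp add: divide_less_eq mult.commute)
  qed
  ultimately have "sin ((real a + real b) * pi / (2 * (real n + 1))) \<noteq> 0"
    using sin_gt_zero by force
  then have Splus: "S (real a + real b) = (1 - cos ((real a - real b) * pi)) / 2"
    using S sin_diff0 cos_eq by metis
  \<comment> \<open>A vanishing term for k = 0 is prepended, which gives the n + 1 terms needed for
    \<open>S\<close>.\<close>
  have "(\<Sum>k<n. sin (real (a * (k + 1)) * pi / (real n + 1)) * sin (real ((k + 1) * b) * pi / (real n + 1)))
    = (\<Sum>k<Suc n. sin (real (a * k) * pi / (real n + 1)) * sin (real (k * b) * pi / (real n + 1)))"
    unfolding sum.lessThan_Suc_shift by simp
  also have "\<dots> = (\<Sum>k<Suc n. (cos (2 * real k * ((real a - real b) * pi / (2 * (real n + 1)))) -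
      cos (2 * real k * ((real a + real b) * pi / (2 * (real n + 1))))) / 2)"
  proof (rule sum.cong[OF refl])
    fix k
    have "2 * real k * (d * pi / (2 * (real n + 1))) = real k * d * pi / (real n + 1)" for d
      by (simp only: times_divide_eq_right mult.assoc mult_divide_mult_cancel_left_if) simp
    moreover have "real (a * k) * pi / (real n + 1) - real (k * b) * pi / (real n + 1) =
        real k * (real a - real b) * pi / (real n + 1)"
      unfolding diff_divide_distrib[symmetric] by (simp add: algebra_simps)
    moreover have "real (a * k) * pi / (real n + 1) + real (k * b) * pi / (real n + 1) =
        real k * (real a + real b) * pi / (real n + 1)"
      unfolding add_divide_distrib[symmetric] by (simp add: algebra_simps)
    ultimately show "sin (real (a * k) * pi / (real n + 1)) * sin (real (k * b) * pi / (real n + 1)) =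
        (cos (2 * real k * ((real a - real b) * pi / (2 * (real n + 1)))) -
         cos (2 * real k * ((real a + real b) * pi / (2 * (real n + 1))))) / 2"
      by (simp only: sin_times_sin)
  qed
  also have "\<dots> = (S (real a - real b) - S (real a + real b)) / 2"
    unfolding S_def by (simp only: sum_subtractf sum_divide_distrib diff_divide_distrib)
  also have "\<dots> = (if a = b then (real n + 1) / 2 else 0)"
  proof (cases "a = b")
    case True
    then show ?thesis
      using Splus by (simp add: S_def)
  next
    case False
    \<comment> \<open>The angle lies strictly between -pi and pi, where the only zero of the sine is
      0; that would force a = b.\<close>
    have "sin ((real a - real b) * pi / (2 * (real n + 1))) \<noteq> 0"
    proof
      assume "sin ((real a - real b) * pi / (2 * (real n + 1))) = 0"
      moreover have "- pi < (real a - real b) * pi / (2 * (real n + 1))"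
        "(real a - real b) * pi / (2 * (real n + 1)) < pi"
      proof -
        have "(real a - real b) * pi < (2 * (real n + 1)) * pi"
          "(real b - real a) * pi < (2 * (real n + 1)) * pi"
          using a b by (auto intro!: mult_strict_right_mono)
        then show "- pi < (real a - real b) * pi / (2 * (real n + 1))"
          "(real a - real b) * pi / (2 * (real n + 1)) < pi"
          by (simp_all add: divide_less_eq less_divide_eq algebra_simps)
      qed
      ultimately show False
        using sin_eq_0_pi False by force
    qed
    then show ?thesis
      using Splus S[OF sin_diff0(1)] False by (simp only: diff_self if_False) simp
  qed
  finally show ?thesis .
qed


lemma sin_pi_fraction_eq_0_iff:
  "sin (real k * pi / (real n + 1)) = 0 \<longleftrightarrow> (n + 1) dvd k"
proof
  assume "sin (real k * pi / (real n + 1)) = 0"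
  then obtain i :: int where "real k * pi / (real n + 1) = of_int i * pi"
    by (auto simp: sin_zero_iff_int2)
  then have "real k * pi = (of_int i * (real n + 1)) * pi"
    by (simp add: field_simps)
  then have "real k = of_int i * (real n + 1)"
    by simp
  then have "real_of_int (int k) = real_of_int (i * (int n + 1))"
    by simp
  then have "int k = i * int (n + 1)"
    unfolding of_int_eq_iff by simp
  then have "int (n + 1) dvd int k"
    by simp
  then show "(n + 1) dvd k"
    by (simp only: int_dvd_int_iff)
next
  assume "(n + 1) dvd k"
  then obtain q where "k = (n + 1) * q" ..
  then have "real k * pi / (real n + 1) = real q * pi"
    by (simp add: field_simps)
  then show "sin (real k * pi / (real n + 1)) = 0"
    by (simp add: sin_npi)
qed

text \<open>The orthonormal discrete sine transform of type I, indexed from 0. Being real, symmetric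
  and orthogonal it is its own inverse, so conjugation takes the form
  \<open>U * M * U\<close>.\<close>

definition sine_matrix :: "nat \<Rightarrow> complex mat" where
  "sine_matrix n = mat n n (\<lambda>(i, j).
     complex_of_real (sqrt (2 / (real n + 1)) * sin (real ((i + 1) * (j + 1)) * pi / (real n + 1))))"

lemma sine_matrix_carrier [simp]: "sine_matrix n \<in> carrier_mat n n"
  by (simp add: sine_matrix_def)

lemma dim_sine_matrix [simp]: "dim_row (sine_matrix n) = n" "dim_col (sine_matrix n) = n"
  by (simp_all add: sine_matrix_def)

lemma sine_matrix_index:
  "i < n \<Longrightarrow> j < n \<Longrightarrow> sine_matrix n $$ (i, j) =
     complex_of_real (sqrt (2 / (real n + 1)) * sin (real ((i + 1) * (j + 1)) * pi / (real n + 1)))"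
  by (simp add: sine_matrix_def)

lemma sine_matrix_sym:
  "i < n \<Longrightarrow> j < n \<Longrightarrow> sine_matrix n $$ (i, j) = sine_matrix n $$ (j, i)"
  by (simp add: sine_matrix_index mult.commute)

lemma sine_matrix_squared: "sine_matrix n * sine_matrix n = 1\<^sub>m n"
proof (rule eq_matI)
  fix i j assume ij: "i < dim_row (1\<^sub>m n :: complex mat)" "j < dim_col (1\<^sub>m n :: complex mat)"
  let ?s = "\<lambda>k. sin (real ((i + 1) * (k + 1)) * pi / (real n + 1)) *
      sin (real ((k + 1) * (j + 1)) * pi / (real n + 1))"
  have "(sine_matrix n * sine_matrix n) $$ (i, j) =
      (\<Sum>k<n. sine_matrix n $$ (i, k) * sine_matrix n $$ (k, j))"
    using ij
    by (simp add: scalar_prod_def atLeast0LessThan)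
  also have "\<dots> = (\<Sum>k<n. complex_of_real (2 / (real n + 1) * ?s k))"
  proof (rule sum.cong[OF refl])
    fix k assume "k \<in> {..<n}"
    \<comment> \<open>The two normalising square roots combine to 2 / (n + 1), the reciprocal of the
      squared norm of an unnormalised sine vector.\<close>
    have *: "(c * x) * (c * y) = (c * c) * (x * y)" for c x y :: real
      by simp
    have "sqrt (2 / (real n + 1)) * sqrt (2 / (real n + 1)) = 2 / (real n + 1)"
      by simp
    then show "sine_matrix n $$ (i, k) * sine_matrix n $$ (k, j) =
        complex_of_real (2 / (real n + 1) * ?s k)"
      using ij \<open>k \<in> {..<n}\<close>
      by (simp only: sine_matrix_index index_one_mat lessThan_iff of_real_mult[symmetric] *)
  qed
  also have "\<dots> = complex_of_real (2 / (real n + 1) * (\<Sum>k<n. ?s k))"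
    by (simp only: of_real_sum sum_distrib_left)
  also have "\<dots> = 1\<^sub>m n $$ (i, j)"
  proof -
    have "2 / (real n + 1) * (if i + 1 = j + 1 then (real n + 1) / 2 else 0) = (if i = j then 1 else 0)"
      by simp
    then show ?thesis
      using ij sum_sin_mult_sin[of "i + 1" n "j + 1"] by simp
  qed
  finally show "(sine_matrix n * sine_matrix n) $$ (i, j) = 1\<^sub>m n $$ (i, j)" .
qed (simp_all add: sine_matrix_def)

section \<open>Diagonalisation of the adjacency matrix and the image of the diagonal unit\<close>

lemma path_adjacency_index:
  assumes "i < n" "j < n"
  shows "path_adjacency n $$ (i, j) = (if i = Suc j \<or> j = Suc i then 1 else 0)"
proof -
  have "{i + 1, j + 1} \<in> path_edges n \<longleftrightarrow> \<bar>int i - int j\<bar> = 1"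
  proof
    assume "\<bar>int i - int j\<bar> = 1"
    then show "{i + 1, j + 1} \<in> path_edges n"
      unfolding path_edges_def using assms by (intro CollectI exI[of _ "i + 1"] exI[of _ "j + 1"]) auto
  qed (auto simp: path_edges_def doubleton_eq_iff)
  also have "\<dots> \<longleftrightarrow> i = Suc j \<or> j = Suc i"
    by auto
  finally show ?thesis
    using assms by (simp add: path_adjacency_def)
qed

text \<open>Row \<open>i\<close> belongs to vertex i + 1, whose neighbours are i and i + 2. Adding
  fictitious vertices 0 and n + 1 on which \<open>f\<close> vanishes lets the two end rows obey the
  same formula as the interior ones.\<close>

lemma sum_path_neighbours:
  fixes f :: "nat \<Rightarrow> 'a :: comm_semiring_1"
  assumes "i < n" "f 0 = 0" "f (Suc n) = 0"
  shows "(\<Sum>j<n. (if i = Suc j \<or> j = Suc i then 1 else 0) * f (Suc j)) = f i + f (Suc (Suc i))"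
proof -
  have "(\<Sum>j<n. (if i = Suc j \<or> j = Suc i then 1 else 0) * f (Suc j)) =
      (\<Sum>j<n. if i = Suc j then f i else 0) + (\<Sum>j<n. if j = Suc i then f (Suc (Suc i)) else 0)"
    unfolding sum.distrib[symmetric] by (intro sum.cong refl) auto
  also have "(\<Sum>j<n. if j = Suc i then f (Suc (Suc i)) else 0) = f (Suc (Suc i))"
  proof (cases "Suc i < n")
    case False
    then have "Suc i = n" using assms(1) by simp
    then show ?thesis using assms(3) by simp
  qed simp
  also have "(\<Sum>j<n. if i = Suc j then f i else 0) = f i"
    using assms(1,2) by (cases i) simp_all
  finally show ?thesis .
qed

definition path_eigenvalue :: "nat \<Rightarrow> nat \<Rightarrow> complex" where
  "path_eigenvalue n s = complex_of_real (2 * cos (real (s + 1) * pi / (real n + 1)))"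

text \<open>The angles lie in [0, pi], where the cosine is injective. Distinctness of the
  eigenvalues is what later allows interpolation to isolate a single diagonal entry.\<close>

lemma inj_on_path_eigenvalue: "inj_on (path_eigenvalue n) {..<n}"
proof (rule inj_onI)
  fix s r assume sr: "s \<in> {..<n}" "r \<in> {..<n}" and eq: "path_eigenvalue n s = path_eigenvalue n r"
  have range: "0 \<le> real (k + 1) * pi / (real n + 1)" "real (k + 1) * pi / (real n + 1) \<le> pi"
    if "k < n" for k
    using that by (simp_all add: divide_le_eq mult.commute)
  have "real (s + 1) * pi / (real n + 1) = real (r + 1) * pi / (real n + 1)"
  proof (rule cos_inj_pi)
    show "cos (real (s + 1) * pi / (real n + 1)) = cos (real (r + 1) * pi / (real n + 1))"
      using eq unfolding path_eigenvalue_def of_real_eq_iff by simp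
  qed (use range sr in blast)+
  then show "s = r"
    by simp
qed

text \<open>Column by column this is the eigenvector equation, which comes from sin((k-1)x) +
  sin((k+1)x) = 2 cos x sin(kx).\<close>

lemma path_adjacency_mult_sine_matrix:
  "path_adjacency n * sine_matrix n = sine_matrix n * mat_diag n (path_eigenvalue n)"
proof (rule eq_matI)
  fix i s
  assume "i < dim_row (sine_matrix n * mat_diag n (path_eigenvalue n))"
    "s < dim_col (sine_matrix n * mat_diag n (path_eigenvalue n))"
  then have il: "i < n" "s < n"
    by (simp_all add: sine_matrix_def mat_diag_def)
  let ?x = "real (s + 1) * pi / (real n + 1)"
  \<comment> \<open>\<open>f\<close> extends column \<open>s\<close> to all naturals, indexed by
    vertices instead of matrix indices. It vanishes at 0 and, because (n + 1) x = (s + 1) pi, also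
    at n + 1.\<close>
  define f where "f k = complex_of_real (sqrt (2 / (real n + 1)) * sin (real k * ?x))" for k
  have U: "sine_matrix n $$ (j, s) = f (Suc j)" if "j < n" for j
    unfolding sine_matrix_index[OF that il(2)] f_def
    by (simp only: of_nat_mult mult.assoc times_divide_eq_right Suc_eq_plus1)
  have "real (Suc n) * ?x = real (s + 1) * pi"
    by (simp add: field_simps)
  then have f_bd: "f 0 = 0" "f (Suc n) = 0"
    unfolding f_def by (simp_all only: sin_npi) simp_all
  have "(path_adjacency n * sine_matrix n) $$ (i, s) =
      (\<Sum>j<n. path_adjacency n $$ (i, j) * sine_matrix n $$ (j, s))"
    using il by (simp add: path_adjacency_def sine_matrix_def scalar_prod_def atLeast0LessThan)
  also have "\<dots> = (\<Sum>j<n. (if i = Suc j \<or> j = Suc i then 1 else 0) * f (Suc j))"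
    using il by (intro sum.cong refl) (simp add: path_adjacency_index U)
  also have "\<dots> = f i + f (Suc (Suc i))"
    using il f_bd by (intro sum_path_neighbours) auto
  also have "\<dots> = f (Suc i) * path_eigenvalue n s"
  proof -
    have "sin (real i * y) + sin (real (Suc (Suc i)) * y) = sin (real (Suc i) * y) * (2 * cos y)" for y
    proof -
      have "real i * y = real (Suc i) * y - y" "real (Suc (Suc i)) * y = real (Suc i) * y + y"
        by (simp_all add: algebra_simps)
      then show ?thesis
        by (simp only: sin_add sin_diff)
    qed
    from this[of ?x] show ?thesis
      unfolding f_def path_eigenvalue_def of_real_mult[symmetric] of_real_add[symmetric]
        distrib_left[symmetric] by (simp only: mult.assoc)
  qed
  also have "\<dots> = (sine_matrix n * mat_diag n (path_eigenvalue n)) $$ (i, s)"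
    using il by (simp add: mat_diag_mult_right[OF sine_matrix_carrier] U)
  finally show "(path_adjacency n * sine_matrix n) $$ (i, s) =
      (sine_matrix n * mat_diag n (path_eigenvalue n)) $$ (i, s)" .
qed (simp_all add: sine_matrix_def path_adjacency_def mat_diag_def)

lemma sine_matrix_conj_path_adjacency:
  "sine_matrix n * path_adjacency n * sine_matrix n = mat_diag n (path_eigenvalue n)"
proof -
  have A: "path_adjacency n \<in> carrier_mat n n"
    by (simp add: path_adjacency_def)
  have "sine_matrix n * path_adjacency n * sine_matrix n =
      sine_matrix n * (sine_matrix n * mat_diag n (path_eigenvalue n))"
    by (simp add: assoc_mult_mat[OF sine_matrix_carrier A sine_matrix_carrier]
        path_adjacency_mult_sine_matrix)
  also have "\<dots> = sine_matrix n * sine_matrix n * mat_diag n (path_eigenvalue n)"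
    by (rule assoc_mult_mat[symmetric]) (auto simp: mat_diag_def)
  finally show ?thesis
    by (simp add: sine_matrix_squared mat_diag_def)
qed

text \<open>The product is column \<open>m\<close> times row \<open>m\<close> of the sine matrix,
  and by symmetry the row is the transposed column. Here \<open>m\<close> is a matrix index, hence
  the vertex \<open>Suc m\<close>.\<close>

lemma sine_matrix_conj_diagonal_unit:
  assumes "m < n"
  shows "sine_matrix n * diagonal_unit n (Suc m) * sine_matrix n =
    mat n n (\<lambda>(i, j). sine_matrix n $$ (i, m) * sine_matrix n $$ (j, m))"
proof (rule eq_matI)
  fix i j
  assume "i < dim_row (mat n n (\<lambda>(i, j). sine_matrix n $$ (i, m) * sine_matrix n $$ (j, m)))"
    "j < dim_col (mat n n (\<lambda>(i, j). sine_matrix n $$ (i, m) * sine_matrix n $$ (j, m)))"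
  then have ij: "i < n" "j < n" by simp_all
  have E: "(sine_matrix n * diagonal_unit n (Suc m)) $$ (i, l) =
      (if l = m then sine_matrix n $$ (i, m) else 0)" if "l < n" for l
  proof -
    have "(sine_matrix n * diagonal_unit n (Suc m)) $$ (i, l) =
        (\<Sum>k<n. sine_matrix n $$ (i, k) * diagonal_unit n (Suc m) $$ (k, l))"
      using ij that by (simp add: diagonal_unit_def sine_matrix_def scalar_prod_def atLeast0LessThan)
    also have "\<dots> = (\<Sum>k<n. if k = m then (if l = m then sine_matrix n $$ (i, m) else 0) else 0)"
      using that by (intro sum.cong refl) (simp add: diagonal_unit_def)
    finally show ?thesis
      using assms by simp
  qed
  have "(sine_matrix n * diagonal_unit n (Suc m) * sine_matrix n) $$ (i, j) =
      (\<Sum>l<n. (sine_matrix n * diagonal_unit n (Suc m)) $$ (i, l) * sine_matrix n $$ (l, j))"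
    using ij
    by (simp add: diagonal_unit_def scalar_prod_def atLeast0LessThan)
  also have "\<dots> = (\<Sum>l<n. if l = m then sine_matrix n $$ (i, m) * sine_matrix n $$ (m, j) else 0)"
    by (intro sum.cong refl) (simp add: E)
  also have "\<dots> = sine_matrix n $$ (i, m) * sine_matrix n $$ (j, m)"
    using assms ij sine_matrix_sym[of m n j] by simp
  finally show "(sine_matrix n * diagonal_unit n (Suc m) * sine_matrix n) $$ (i, j) =
      mat n n (\<lambda>(i, j). sine_matrix n $$ (i, m) * sine_matrix n $$ (j, m)) $$ (i, j)"
    using ij by simp
qed (simp_all add: sine_matrix_def)

lemma sine_matrix_eq_0_iff:
  assumes "i < n" "m < n"
  shows "sine_matrix n $$ (i, m) = 0 \<longleftrightarrow> (n + 1) dvd (i + 1) * (m + 1)"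
  unfolding sine_matrix_index[OF assms] of_real_eq_0_iff sin_pi_fraction_eq_0_iff[symmetric]
  by simp

subsection \<open>Algebras generated by a diagonal and a rank-one matrix\<close>

lemma unital_subalgebra_mat_iff:
  "unital_subalgebra class_ring (module_mat TYPE('a :: comm_ring_1) n n) S \<longleftrightarrow>
     S \<subseteq> carrier_mat n n \<and> 0\<^sub>m n n \<in> S \<and> 1\<^sub>m n \<in> S \<and>
     (\<forall>x\<in>S. \<forall>y\<in>S. x + y \<in> S) \<and> (\<forall>x\<in>S. \<forall>y\<in>S. x * y \<in> S) \<and> (\<forall>c. \<forall>x\<in>S. c \<cdot>\<^sub>m x \<in> S)"
  by (simp add: unital_subalgebra_def module_mat_simps)

lemma vectorspace_unital_subalgebra:
  fixes S :: "'a :: field mat set"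
  assumes "unital_subalgebra class_ring (module_mat TYPE('a) n n) S"
  shows "vectorspace class_ring ((module_mat TYPE('a) n n)\<lparr>carrier := S\<rparr>)"
proof -
  interpret V: vectorspace class_ring "module_mat TYPE('a) n n"
    by (rule matrix_vs)
  have "LinearCombinations.submodule class_ring S (module_mat TYPE('a) n n)"
    using assms V.module_axioms
    by (auto simp: LinearCombinations.submodule_def unital_subalgebra_def)
  then show ?thesis
    by (intro V.subspace_is_vs) (simp add: VectorSpace.subspace_def V.vectorspace_axioms)
qed

section \<open>Composition of algebra isomorphisms and invariance of dimension\<close>

lemma algebra_iso_trans:
  assumes g: "g \<in> algebra_iso K A B" and h: "h \<in> algebra_iso K B C"
  shows "h \<circ> g \<in> algebra_iso K A C"
proof -
  have "g \<in> ring_iso A B" "h \<in> ring_iso B C"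
    using g h by (simp_all add: algebra_iso_def)
  then show ?thesis
    using g h ring_iso_memE(1)[of g A B] unfolding algebra_iso_def
    by (auto intro: ring_iso_set_trans)
qed

lemma algebra_iso_dim:
  assumes A: "vectorspace K A" and B: "vectorspace K B" and h: "h \<in> algebra_iso K A B"
    and fin: "vectorspace.fin_dim K A"
  shows "vectorspace.fin_dim K B" and "vectorspace.dim K B = vectorspace.dim K A"
proof -
  interpret A: vectorspace K A by (rule A)
  interpret B: vectorspace K B by (rule B)
  have ri: "h \<in> ring_iso A B"
    using h by (simp add: algebra_iso_def)
  then have "h \<in> LinearCombinations.module_hom K A B"
    using h by (auto simp: LinearCombinations.module_hom_def algebra_iso_def ring_iso_def Ring.ring_hom_def)
  then interpret linear_map K A B h
    by unfold_locales
  have bij: "inj_on h (carrier A)" "h ` carrier A = carrier B"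
    using ri by (auto simp: ring_iso_def bij_betw_def)
  show "vectorspace.fin_dim K B"
    using surj_fin_dim[OF fin bij(2)] .
  show "vectorspace.dim K B = vectorspace.dim K A"
    using dim_eq[OF fin bij] by simp
qed

text \<open>With the indices of \<open>Z\<close> moved to the end, these are the block matrices with
  an arbitrary block off \<open>Z\<close> and a diagonal block on \<open>Z\<close>. Prescribing
  zeros avoids any reordering, as \<open>Z\<close> need not be an interval.\<close>

definition split_mats :: "nat \<Rightarrow> nat set \<Rightarrow> 'a :: zero mat set" where
  "split_mats n Z = {M \<in> carrier_mat n n. \<forall>i<n. \<forall>j<n. i \<noteq> j \<longrightarrow> i \<in> Z \<or> j \<in> Z \<longrightarrow> M $$ (i, j) = 0}"

lemma split_mats_carrier: "M \<in> split_mats n Z \<Longrightarrow> M \<in> carrier_mat n n"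
  by (simp add: split_mats_def)

lemma split_mats_eq_0:
  "M \<in> split_mats n Z \<Longrightarrow> i < n \<Longrightarrow> j < n \<Longrightarrow> i \<noteq> j \<Longrightarrow> i \<in> Z \<or> j \<in> Z \<Longrightarrow> M $$ (i, j) = 0"
  by (auto simp: split_mats_def)

lemma mult_mat_index:
  assumes "M \<in> carrier_mat n n" "N \<in> carrier_mat n n" "i < n" "j < n"
  shows "(M * N) $$ (i, j) = (\<Sum>k<n. M $$ (i, k) * N $$ (k, j))"
  using assms by (simp add: scalar_prod_def atLeast0LessThan)

text \<open>A row or column with index in \<open>Z\<close> has at most its diagonal entry, so the
  sum collapses to one term; for \<open>i\<close> and \<open>j\<close> outside \<open>Z\<close> the
  summands with \<open>k\<close> in \<open>Z\<close> vanish. This yields both closure under products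
  and multiplicativity of the projection to the blocks.\<close>

lemma split_mats_mult_index:
  fixes M N :: "'a :: semiring_1 mat"
  assumes M: "M \<in> split_mats n Z" and N: "N \<in> split_mats n Z" and ij: "i < n" "j < n"
  shows "(M * N) $$ (i, j) = (if i \<in> Z then M $$ (i, i) * N $$ (i, j)
    else if j \<in> Z then M $$ (i, j) * N $$ (j, j)
    else (\<Sum>k\<in>{..<n} - Z. M $$ (i, k) * N $$ (k, j)))"
proof -
  have MN: "(M * N) $$ (i, j) = (\<Sum>k<n. M $$ (i, k) * N $$ (k, j))"
    using mult_mat_index[OF split_mats_carrier[OF M] split_mats_carrier[OF N] ij] .
  consider "i \<in> Z" | "i \<notin> Z" "j \<in> Z" | "i \<notin> Z" "j \<notin> Z" by blast
  then show ?thesis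
  proof cases
    case 1
    then have "(\<Sum>k<n. M $$ (i, k) * N $$ (k, j)) = (\<Sum>k\<in>{i}. M $$ (i, k) * N $$ (k, j))"
      using ij by (intro sum.mono_neutral_right) (auto simp: split_mats_eq_0[OF M])
    then show ?thesis using 1 MN by simp
  next
    case 2
    then have "(\<Sum>k<n. M $$ (i, k) * N $$ (k, j)) = (\<Sum>k\<in>{j}. M $$ (i, k) * N $$ (k, j))"
      using ij by (intro sum.mono_neutral_right) (auto simp: split_mats_eq_0[OF N])
    then show ?thesis using 2 MN by simp
  next
    case 3
    then have "M $$ (i, k) = 0" if "k < n" "k \<in> Z" for k
      using split_mats_eq_0[OF M ij(1) that(1)] that(2) by blast
    then have "(\<Sum>k<n. M $$ (i, k) * N $$ (k, j)) = (\<Sum>k\<in>{..<n} - Z. M $$ (i, k) * N $$ (k, j))"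
      by (intro sum.mono_neutral_right) auto
    then show ?thesis using 3 MN by simp
  qed
qed

lemma unital_subalgebra_split_mats:
  "unital_subalgebra class_ring (module_mat TYPE('a :: comm_ring_1) n n) (split_mats n Z)"
proof -
  have "M * N \<in> split_mats n Z" if M: "M \<in> split_mats n Z" and N: "N \<in> split_mats n Z"
    for M N :: "'a mat"
  proof -
    have "(M * N) $$ (i, j) = 0" if "i < n" "j < n" "i \<noteq> j" "i \<in> Z \<or> j \<in> Z" for i j
      using that by (auto simp: split_mats_mult_index[OF M N] split_mats_eq_0[OF M] split_mats_eq_0[OF N])
    then show ?thesis
      using M N by (auto simp: split_mats_def)
  qed
  then show ?thesis
    by (auto simp: unital_subalgebra_mat_iff) (auto simp: split_mats_def)
qed

text \<open>The matrix is the polynomial with roots \<open>e r\<close> evaluated at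
  \<open>mat_diag n d\<close>, built up one linear factor at a time.\<close>

lemma diagonal_mem_subalgebra:
  fixes d :: "nat \<Rightarrow> 'a :: comm_ring_1"
  assumes S: "unital_subalgebra class_ring (module_mat TYPE('a) n n) S"
    and D: "mat_diag n d \<in> S" and "finite R"
  shows "mat_diag n (\<lambda>i. \<Prod>r\<in>R. d i - e r) \<in> S"
  using \<open>finite R\<close>
proof induction
  case empty
  have "mat_diag n (\<lambda>i. 1) = (1\<^sub>m n :: 'a mat)"
    by (auto simp: mat_diag_def)
  then show ?case
    using S by (simp add: unital_subalgebra_mat_iff)
next
  case (insert r R)
  have "mat_diag n (\<lambda>i. d i - e r) = mat_diag n d + (- e r) \<cdot>\<^sub>m 1\<^sub>m n"
    by (auto simp: mat_diag_def)
  then have "mat_diag n (\<lambda>i. d i - e r) \<in> S"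
    using S D by (simp add: unital_subalgebra_mat_iff)
  then have "mat_diag n (\<lambda>i. d i - e r) * mat_diag n (\<lambda>i. \<Prod>r\<in>R. d i - e r) \<in> S"
    using S insert.IH by (simp add: unital_subalgebra_mat_iff del: mat_diag_diag)
  then show ?case
    using insert.hyps by simp
qed

text \<open>Lagrange interpolation: the product over all nodes other than \<open>d s\<close>
  vanishes at every index except \<open>s\<close>, where injectivity of \<open>d\<close> makes it
  nonzero, so it can be normalised.\<close>

lemma diagonal_matrix_unit_mem_subalgebra:
  fixes d :: "nat \<Rightarrow> 'a :: field"
  assumes S: "unital_subalgebra class_ring (module_mat TYPE('a) n n) S"
    and D: "mat_diag n d \<in> S" and inj: "inj_on d {..<n}" and s: "s < n"
  shows "mat_diag n (\<lambda>i. if i = s then 1 else 0) \<in> S"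
proof -
  let ?c = "\<lambda>i. \<Prod>r\<in>{..<n} - {s}. d i - d r"
  have c0: "?c s \<noteq> 0"
    using inj s by (auto simp: inj_on_def)
  have "?c i = 0" if "i < n" "i \<noteq> s" for i
    using that by (intro prod_zero) auto
  then have "mat_diag n (\<lambda>i. if i = s then 1 else 0) = inverse (?c s) \<cdot>\<^sub>m mat_diag n ?c"
    using c0 by (auto simp: mat_diag_def)
  moreover have "mat_diag n ?c \<in> S"
    by (rule diagonal_mem_subalgebra[OF S D]) simp
  ultimately show ?thesis
    using S by (simp add: unital_subalgebra_mat_iff)
qed

text \<open>Cutting the rank-one matrix down by the diagonal units at \<open>s\<close> and
  \<open>r\<close> leaves w_s w_r times the matrix unit at (s, r). So \<open>S\<close> contains all
  diagonal units and every unit whose two weights are nonzero, and these span the split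
  matrices.\<close>

lemma split_mats_subset_subalgebra:
  fixes d w :: "nat \<Rightarrow> 'a :: field"
  assumes S: "unital_subalgebra class_ring (module_mat TYPE('a) n n) S"
    and D: "mat_diag n d \<in> S" and inj: "inj_on d {..<n}"
    and W: "mat n n (\<lambda>(i, j). w i * w j) \<in> S"
  shows "split_mats n {i. w i = 0} \<subseteq> S"
proof
  fix M :: "'a mat" assume M: "M \<in> split_mats n {i. w i = 0}"
  let ?E = "\<lambda>s r. mat n n (\<lambda>(i, j). if i = s \<and> j = r then 1 else 0) :: 'a mat"
  have diag: "mat_diag n (\<lambda>i. if i = s then 1 else 0) \<in> S" if "s < n" for s
    by (rule diagonal_matrix_unit_mem_subalgebra[OF S D inj that])
  have unit: "?E s r \<in> S" if sr: "s < n" "r < n" and "s = r \<or> w s \<noteq> 0 \<and> w r \<noteq> 0" for s r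
  proof (cases "s = r")
    case True
    then have "?E s r = mat_diag n (\<lambda>i. if i = s then 1 else 0)"
      by (auto simp: mat_diag_def)
    then show ?thesis using diag sr by simp
  next
    case False
    let ?W = "mat n n (\<lambda>(i, j). w i * w j)"
    have "mat_diag n (\<lambda>i. if i = s then 1 else 0) * ?W * mat_diag n (\<lambda>i. if i = r then 1 else 0)
        = (w s * w r) \<cdot>\<^sub>m ?E s r"
      by (auto simp: mat_diag_mult_left[of _ n n] mat_diag_mult_right[of _ n n])
    moreover have "?E s r = inverse (w s * w r) \<cdot>\<^sub>m ((w s * w r) \<cdot>\<^sub>m ?E s r)"
      using that False by (intro eq_matI) (auto simp: field_simps)
    ultimately have "?E s r = inverse (w s * w r) \<cdot>\<^sub>m
        (mat_diag n (\<lambda>i. if i = s then 1 else 0) * ?W * mat_diag n (\<lambda>i. if i = r then 1 else 0))"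
      by simp
    then show ?thesis
      using S W diag sr by (simp add: unital_subalgebra_mat_iff)
  qed
  \<comment> \<open>\<open>M\<close> is assembled one position at a time. A nonzero off-diagonal
    entry of \<open>M\<close> forces both weights to be nonzero, so the unit needed is available;
    any other position outside the diagonal adds nothing.\<close>
  have "mat n n (\<lambda>ij. if ij \<in> R then M $$ ij else 0) \<in> S" if "finite R" for R
    using that
  proof induction
    case empty
    then show ?case
      using S by (simp add: unital_subalgebra_mat_iff zero_mat_def)
  next
    case (insert sr R)
    obtain s r where sr: "sr = (s, r)" by fastforce
    let ?f = "\<lambda>R. mat n n (\<lambda>ij. if ij \<in> R then M $$ ij else 0)"
    show ?case
    proof (cases "s < n \<and> r < n \<and> M $$ (s, r) \<noteq> 0")
      case True
      then have "s = r \<or> w s \<noteq> 0 \<and> w r \<noteq> 0"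
        using M by (auto simp: split_mats_def)
      then have "?E s r \<in> S"
        using unit True by blast
      moreover have "?f (insert sr R) = ?f R + M $$ (s, r) \<cdot>\<^sub>m ?E s r"
        using insert.hyps sr by auto
      ultimately show ?thesis
        using S insert.IH by (simp add: unital_subalgebra_mat_iff)
    next
      case False
      then have "?f (insert sr R) = ?f R"
        using sr by auto
      then show ?thesis using insert.IH by simp
    qed
  qed
  from this[of "{..<n} \<times> {..<n}"]
  have "mat n n (\<lambda>ij. if ij \<in> {..<n} \<times> {..<n} then M $$ ij else 0) \<in> S"
    by simp
  also have "mat n n (\<lambda>ij. if ij \<in> {..<n} \<times> {..<n} then M $$ ij else 0) = M"
    using split_mats_carrier[OF M] by auto
  finally show "M \<in> S" .
qed

section \<open>Transport of subalgebras by conjugation with an involution\<close>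

definition conj_preimage :: "nat \<Rightarrow> 'a :: semiring_1 mat \<Rightarrow> 'a mat set \<Rightarrow> 'a mat set" where
  "conj_preimage n U S = {M \<in> carrier_mat n n. U * M * U \<in> S}"

context
  fixes n :: nat and U :: "'a :: comm_ring_1 mat"
  assumes U: "U \<in> carrier_mat n n" and UU: "U * U = 1\<^sub>m n"
begin

lemma involution_conj_carrier: "M \<in> carrier_mat n n \<Longrightarrow> U * M * U \<in> carrier_mat n n"
  using U by simp

lemma involution_conj_conj:
  assumes M: "M \<in> carrier_mat n n"
  shows "U * (U * M * U) * U = M"
proof -
  have "U * (U * M * U) * U = (U * U) * M * (U * U)"
    using U M by (simp add: assoc_mult_mat[of _ n n _ n _ n])
  then show ?thesis
    using M by (simp add: UU)
qed

lemma involution_conj_mult: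
  assumes M: "M \<in> carrier_mat n n" and N: "N \<in> carrier_mat n n"
  shows "U * (M * N) * U = (U * M * U) * (U * N * U)"
proof -
  have "(U * M * U) * (U * N * U) = U * M * (U * U) * N * U"
    using U M N by (simp add: assoc_mult_mat[of _ n n _ n _ n])
  then show ?thesis
    using U M N by (simp add: UU assoc_mult_mat[of _ n n _ n _ n])
qed

lemma involution_conj_add:
  assumes M: "M \<in> carrier_mat n n" and N: "N \<in> carrier_mat n n"
  shows "U * (M + N) * U = U * M * U + U * N * U"
  using U M N by (simp add: mult_add_distrib_mat[of _ n n] add_mult_distrib_mat[of _ n n])

lemma involution_conj_smult:
  assumes M: "M \<in> carrier_mat n n"
  shows "U * (c \<cdot>\<^sub>m M) * U = c \<cdot>\<^sub>m (U * M * U)"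
  using U M by (simp add: mult_smult_distrib[of _ n n] mult_smult_assoc_mat[of _ n n])

text \<open>Conjugation by an involution is its own inverse, so the preimage of \<open>S\<close> is
  also its image. This permits moving inclusions and isomorphisms in either direction.\<close>

lemma involution_conj_preimage_twice:
  assumes "S \<subseteq> carrier_mat n n"
  shows "conj_preimage n U (conj_preimage n U S) = S"
  using assms by (auto simp: conj_preimage_def involution_conj_conj involution_conj_carrier)

lemma unital_subalgebra_conj_preimage:
  assumes S: "unital_subalgebra class_ring (module_mat TYPE('a) n n) S"
  shows "unital_subalgebra class_ring (module_mat TYPE('a) n n) (conj_preimage n U S)"
proof -
  have "U * 0\<^sub>m n n * U = 0\<^sub>m n n" "U * 1\<^sub>m n * U = 1\<^sub>m n"
    using U UU by simp_all
  then show ?thesis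
    using S unfolding unital_subalgebra_mat_iff conj_preimage_def
    by (auto simp: involution_conj_mult involution_conj_add involution_conj_smult)
qed

lemma involution_conj_algebra_iso:
  assumes "S \<subseteq> carrier_mat n n"
  shows "(\<lambda>M. U * M * U) \<in> algebra_iso class_ring
    ((module_mat TYPE('a) n n)\<lparr>carrier := conj_preimage n U S\<rparr>) ((module_mat TYPE('a) n n)\<lparr>carrier := S\<rparr>)"
proof -
  have "bij_betw (\<lambda>M. U * M * U) (conj_preimage n U S) S"
    using assms by (intro bij_betwI[of _ _ _ "\<lambda>M. U * M * U"])
      (auto simp: conj_preimage_def involution_conj_conj involution_conj_carrier)
  moreover have "U * 1\<^sub>m n * U = 1\<^sub>m n"
    using U UU by simp
  ultimately show ?thesis
    unfolding algebra_iso_def ring_iso_def Ring.ring_hom_def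
    by (auto simp: module_mat_simps conj_preimage_def involution_conj_mult involution_conj_add
        involution_conj_smult)
qed

end

text \<open>The right-hand carrier is a unital subalgebra containing \<open>A\<close> and
  \<open>E\<close>. Conversely, if \<open>S\<close> is any such subalgebra, its conjugate contains
  the diagonal and the rank-one matrix, hence all split matrices; conjugating back shows that
  \<open>S\<close> contains the carrier.\<close>

lemma generated_subalgebra_eq_conj_preimage:
  fixes U :: "'a :: field mat"
  assumes U: "U \<in> carrier_mat n n" and UU: "U * U = 1\<^sub>m n"
    and A: "A \<in> carrier_mat n n" and E: "E \<in> carrier_mat n n"
    and UAU: "U * A * U = mat_diag n d" and inj: "inj_on d {..<n}"
    and UEU: "U * E * U = mat n n (\<lambda>(i, j). w i * w j)"
  shows "generated_subalgebra class_ring (module_mat TYPE('a) n n) {A, E} =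
    (module_mat TYPE('a) n n)\<lparr>carrier := conj_preimage n U (split_mats n {i. w i = 0})\<rparr>"
proof -
  let ?B = "split_mats n {i. w i = 0} :: 'a mat set"
  have "conj_preimage n U ?B \<subseteq> S"
    if S: "unital_subalgebra class_ring (module_mat TYPE('a) n n) S" and AE: "{A, E} \<subseteq> S" for S
  proof -
    have Scar: "S \<subseteq> carrier_mat n n"
      using S by (simp add: unital_subalgebra_mat_iff)
    have "?B \<subseteq> conj_preimage n U S"
    proof (rule split_mats_subset_subalgebra)
      show "unital_subalgebra class_ring (module_mat TYPE('a) n n) (conj_preimage n U S)"
        by (rule unital_subalgebra_conj_preimage[OF U UU S])
      show "mat_diag n d \<in> conj_preimage n U S"
        using AE involution_conj_conj[OF U UU A] UAU by (simp add: conj_preimage_def)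
      show "mat n n (\<lambda>(i, j). w i * w j) \<in> conj_preimage n U S"
        using AE involution_conj_conj[OF U UU E] UEU by (simp add: conj_preimage_def)
    qed (rule inj)
    then have "conj_preimage n U ?B \<subseteq> conj_preimage n U (conj_preimage n U S)"
      by (auto simp: conj_preimage_def)
    then show ?thesis
      by (simp add: involution_conj_preimage_twice[OF U UU Scar])
  qed
  moreover have "unital_subalgebra class_ring (module_mat TYPE('a) n n) (conj_preimage n U ?B)"
    by (rule unital_subalgebra_conj_preimage[OF U UU unital_subalgebra_split_mats])
  moreover have "{A, E} \<subseteq> conj_preimage n U ?B"
    using A E by (auto simp: conj_preimage_def UAU UEU split_mats_def mat_diag_def)
  ultimately show ?thesis
    unfolding generated_subalgebra_def by (intro arg_cong[of _ _ "\<lambda>S. _\<lparr>carrier := S\<rparr>"]) blast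
qed

section \<open>Structure and dimension of the algebra of split matrices\<close>

lemma split_mats_algebra_iso:
  assumes Z: "Z \<subseteq> {..<n}"
  shows "algebra_isomorphic complex_field ((matrix_algebra n)\<lparr>carrier := split_mats n Z\<rparr>)
    (algebra_sum (matrix_algebra (n - card Z)) (algebra_Sum {1..card Z} (\<lambda>_. complex_algebra)))"
proof -
  let ?t = "card Z"
  have finZ: "finite Z"
    using Z finite_subset by blast
  then have "card ({..<n} - Z) = n - ?t"
    using Z by (simp add: card_Diff_subset)
  then obtain p where p: "bij_betw p {..<n - ?t} ({..<n} - Z)"
    using ex_bij_betw_nat_finite[of "{..<n} - Z"] by (auto simp: atLeast0LessThan)
  obtain q where q: "bij_betw q {1..?t} Z"
    using ex_bij_betw_nat_finite_1[OF finZ] by auto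
  have pn: "p i < n" "p i \<notin> Z" if "i < n - ?t" for i
    using bij_betw_apply[OF p] that by auto
  have qn: "q k < n" "q k \<in> Z" if "k \<in> {1..?t}" for k
    using bij_betw_apply[OF q that] Z by auto
  have p_inj: "p i = p j \<longleftrightarrow> i = j" if "i < n - ?t" "j < n - ?t" for i j
    using p that by (auto simp: bij_betw_def inj_on_def)
  \<comment> \<open>\<open>h\<close> reads off the block outside \<open>Z\<close>, renumbered by
    \<open>p\<close>, and the diagonal entries on \<open>Z\<close>, renumbered by \<open>q\<close>.
    The second component is a restricted function because the carrier of \<open>algebra_Sum\<close>
    is extensional.\<close>
  define h :: "complex mat \<Rightarrow> complex mat \<times> (nat \<Rightarrow> complex)" where
    "h M = (mat (n - ?t) (n - ?t) (\<lambda>(i, j). M $$ (p i, p j)), \<lambda>k\<in>{1..?t}. M $$ (q k, q k))" for M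
  let ?B = "split_mats n Z :: complex mat set"
  let ?C = "(carrier_mat (n - ?t) (n - ?t) :: complex mat set) \<times> ({1..?t} \<rightarrow>\<^sub>E (UNIV :: complex set))"
  have h_mult: "h (M * N) = (fst (h M) * fst (h N), \<lambda>k\<in>{1..?t}. snd (h M) k * snd (h N) k)"
    if M: "M \<in> ?B" and N: "N \<in> ?B" for M N
  proof -
    have "mat (n - ?t) (n - ?t) (\<lambda>(i, j). (M * N) $$ (p i, p j)) = fst (h M) * fst (h N)"
    proof (rule eq_matI)
      fix i j
      assume "i < dim_row (fst (h M) * fst (h N))" "j < dim_col (fst (h M) * fst (h N))"
      then have ij: "i < n - ?t" "j < n - ?t"
        by (simp_all add: h_def)
      have "(M * N) $$ (p i, p j) = (\<Sum>k\<in>{..<n} - Z. M $$ (p i, k) * N $$ (k, p j))"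
        using ij by (simp add: split_mats_mult_index[OF M N] pn)
      also have "\<dots> = (\<Sum>k<n - ?t. M $$ (p i, p k) * N $$ (p k, p j))"
        by (rule sum.reindex_bij_betw[OF p, symmetric])
      finally show "mat (n - ?t) (n - ?t) (\<lambda>(i, j). (M * N) $$ (p i, p j)) $$ (i, j) =
          (fst (h M) * fst (h N)) $$ (i, j)"
        using ij by (simp add: h_def scalar_prod_def atLeast0LessThan)
    qed (simp_all add: h_def)
    moreover have "(M * N) $$ (q k, q k) = M $$ (q k, q k) * N $$ (q k, q k)" if "k \<in> {1..?t}" for k
      using that by (simp only: split_mats_mult_index[OF M N] qn if_True)
    ultimately show ?thesis
      by (auto simp: h_def)
  qed
  have h_add: "h (M + N) = (fst (h M) + fst (h N), \<lambda>k\<in>{1..?t}. snd (h M) k + snd (h N) k)"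
    if "M \<in> ?B" "N \<in> ?B" for M N
    using that[THEN split_mats_carrier] by (auto simp: h_def pn qn)
  have h_smult: "h (c \<cdot>\<^sub>m M) = (c \<cdot>\<^sub>m fst (h M), \<lambda>k\<in>{1..?t}. c * snd (h M) k)"
    if "M \<in> ?B" for c M
    using that[THEN split_mats_carrier] by (auto simp: h_def pn qn)
  have h_one: "h (1\<^sub>m n) = (1\<^sub>m (n - ?t), \<lambda>k\<in>{1..?t}. 1)"
    by (auto simp: h_def pn qn p_inj)
  have h_mem: "h M \<in> ?C" if "M \<in> ?B" for M
    by (simp add: h_def)
  have "inj_on h ?B"
  proof (rule inj_onI)
    fix M N assume M: "M \<in> ?B" and N: "N \<in> ?B" and eq: "h M = h N"
    have "M $$ (i, j) = N $$ (i, j)" if ij: "i < n" "j < n" for i j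
    proof -
      consider "i \<in> Z \<or> j \<in> Z" "i \<noteq> j" | "i \<in> Z" "i = j" | "i \<in> {..<n} - Z" "j \<in> {..<n} - Z"
        using ij by auto
      then show ?thesis
      proof cases
        case 1
        then show ?thesis
          using split_mats_eq_0[OF M] split_mats_eq_0[OF N] ij by simp
      next
        case 2
        then obtain k where k: "k \<in> {1..?t}" "i = q k"
          using q unfolding bij_betw_def by blast
        have "snd (h M) k = snd (h N) k"
          using eq by simp
        then show ?thesis
          using k 2 by (simp add: h_def)
      next
        case 3
        then obtain a b where ab: "a < n - ?t" "b < n - ?t" "i = p a" "j = p b"
          using p unfolding bij_betw_def by blast
        have "fst (h M) $$ (a, b) = fst (h N) $$ (a, b)"
          using eq by simp
        then show ?thesis
          using ab by (simp add: h_def)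
      qed
    qed
    then show "M = N"
      using M N by (auto simp: split_mats_def)
  qed
  moreover have "h ` ?B = ?C"
  proof
    show "?C \<subseteq> h ` ?B"
    proof
      fix y assume y: "y \<in> ?C"
      obtain C f where Cf: "y = (C, f)" by fastforce
      let ?p = "inv_into {..<n - ?t} p" and ?q = "inv_into {1..?t} q"
      \<comment> \<open>The inverse image of (C, f): \<open>C\<close> is spread over the complement
        of \<open>Z\<close> and \<open>f\<close> along the diagonal of \<open>Z\<close>, with zeros
        elsewhere.\<close>
      define M where "M = mat n n (\<lambda>(i, j).
        if i \<in> Z \<or> j \<in> Z then (if i = j then f (?q i) else 0) else C $$ (?p i, ?p j))"
      have "M \<in> ?B"
        by (simp add: M_def split_mats_def)
      moreover have "M $$ (p i, p j) = C $$ (i, j)" if "i < n - ?t" "j < n - ?t" for i j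
        using that pn bij_betw_inv_into_left[OF p] by (simp add: M_def)
      moreover have "M $$ (q k, q k) = f k" if "k \<in> {1..?t}" for k
        using qn[OF that] bij_betw_inv_into_left[OF q that] by (simp add: M_def)
      ultimately show "y \<in> h ` ?B"
        using y Cf by (intro image_eqI[of _ _ M]) (auto simp: h_def fun_eq_iff PiE_def extensional_def)
    qed
  qed (use h_mem in blast)
  ultimately have "bij_betw h ?B ?C"
    by (simp add: bij_betw_def)
  then have "h \<in> algebra_iso complex_field ((matrix_algebra n)\<lparr>carrier := ?B\<rparr>)
      (algebra_sum (matrix_algebra (n - ?t)) (algebra_Sum {1..?t} (\<lambda>_. complex_algebra)))"
    unfolding algebra_iso_def ring_iso_def Ring.ring_hom_def algebra_sum_def algebra_Sum_def complex_algebra_def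
    using h_mem by (simp add: module_mat_simps h_mult h_add h_smult h_one)
  then show ?thesis
    unfolding algebra_isomorphic_def by blast
qed

lemma split_mats_dim:
  assumes Z: "Z \<subseteq> {..<n}"
  defines "B \<equiv> (module_mat TYPE('a :: field) n n)\<lparr>carrier := split_mats n Z\<rparr>"
  shows "vectorspace.fin_dim class_ring B" and "vectorspace.dim class_ring B = (n - card Z)\<^sup>2 + card Z"
proof -
  let ?k = "(n - card Z)\<^sup>2 + card Z"
  \<comment> \<open>The positions whose entries are free: the full square off \<open>Z\<close> and
    the diagonal of \<open>Z\<close>. Their number is the dimension.\<close>
  define I where "I = ({..<n} - Z) \<times> ({..<n} - Z) \<union> (\<lambda>i. (i, i)) ` Z"
  have finZ: "finite Z"
    using Z finite_subset by blast
  have "card I = card (({..<n} - Z) \<times> ({..<n} - Z)) + card ((\<lambda>i. (i, i)) ` Z)"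
    unfolding I_def using finZ by (intro card_Un_disjoint) auto
  also have "\<dots> = ?k"
    using Z finZ by (simp add: card_cartesian_product card_Diff_subset card_image inj_on_def power2_eq_square)
  finally have "card I = ?k" .
  moreover have "finite I"
    unfolding I_def using finZ by simp
  ultimately obtain r where r: "bij_betw r I {..<?k}"
    using ex_bij_betw_finite_nat[of I] by (auto simp: atLeast0LessThan)
  have rk: "r ij < ?k" if "ij \<in> I" for ij
    using bij_betw_apply[OF r that] by simp
  have I_iff: "(i, j) \<in> I \<longleftrightarrow> i < n \<and> j < n \<and> (i \<in> Z \<or> j \<in> Z \<longrightarrow> i = j)" for i j
    unfolding I_def using Z by auto
  interpret V: vec_space "TYPE('a)" ?k .
  interpret B: vectorspace class_ring B
    unfolding B_def by (rule vectorspace_unital_subalgebra[OF unital_subalgebra_split_mats])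
  \<comment> \<open>\<open>G\<close> writes the coordinates of a vector into the free positions,
    numbered by \<open>r\<close>; it is the linear isomorphism from which the dimension is read
    off.\<close>
  define G :: "'a vec \<Rightarrow> 'a mat" where "G v = mat n n (\<lambda>ij. if ij \<in> I then v $ r ij else 0)" for v
  have G_mem: "G v \<in> split_mats n Z" for v
    by (auto simp: G_def split_mats_def I_iff)
  have "G \<in> LinearCombinations.module_hom class_ring (module_vec TYPE('a) ?k) B"
    unfolding LinearCombinations.module_hom_def B_def
    using G_mem by (auto simp: module_vec_simps module_mat_simps) (auto simp: G_def rk)
  then interpret G: linear_map class_ring "module_vec TYPE('a) ?k" B G
    by unfold_locales
  have inj: "inj_on G (carrier (module_vec TYPE('a) ?k))"
  proof (rule inj_onI)
    fix v w assume v: "v \<in> carrier (module_vec TYPE('a) ?k)"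
      and w: "w \<in> carrier (module_vec TYPE('a) ?k)" and eq: "G v = G w"
    have "v $ l = w $ l" if "l < ?k" for l
    proof -
      have "l \<in> r ` I"
        using that bij_betw_imp_surj_on[OF r] by simp
      then obtain i j where ij: "(i, j) \<in> I" "l = r (i, j)"
        by (metis imageE surj_pair)
      then have "i < n" "j < n"
        using I_iff by blast+
      then have "G v $$ (i, j) = v $ l" "G w $$ (i, j) = w $ l"
        using ij by (simp_all add: G_def)
      then show ?thesis
        using eq by simp
    qed
    then show "v = w"
      using v w by (auto simp: module_vec_simps)
  qed
  have surj: "G ` carrier (module_vec TYPE('a) ?k) = carrier B"
  proof
    show "carrier B \<subseteq> G ` carrier (module_vec TYPE('a) ?k)"
    proof
      fix M assume "M \<in> carrier B"
      then have M: "M \<in> split_mats n Z"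
        by (simp add: B_def)
      have "M = G (vec ?k (\<lambda>l. M $$ inv_into I r l))"
      proof (rule eq_matI)
        fix i j
        assume "i < dim_row (G (vec ?k (\<lambda>l. M $$ inv_into I r l)))"
          "j < dim_col (G (vec ?k (\<lambda>l. M $$ inv_into I r l)))"
        then have ij: "i < n" "j < n"
          by (simp_all add: G_def)
        have "M $$ (i, j) = 0" if "(i, j) \<notin> I"
          using that ij split_mats_eq_0[OF M ij] unfolding I_iff by blast
        then show "M $$ (i, j) = G (vec ?k (\<lambda>l. M $$ inv_into I r l)) $$ (i, j)"
          using ij bij_betw_inv_into_left[OF r] rk by (simp add: G_def)
      qed (use split_mats_carrier[OF M] in \<open>auto simp: G_def\<close>)
      then show "M \<in> G ` carrier (module_vec TYPE('a) ?k)"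
        unfolding module_vec_simps by (rule image_eqI) (rule vec_carrier)
    qed
  qed (use G_mem in \<open>auto simp: B_def\<close>)
  show "vectorspace.fin_dim class_ring B"
    using G.surj_fin_dim[OF _ surj] V.fin_dim by simp
  show "vectorspace.dim class_ring B = ?k"
    using G.dim_eq[OF _ inj surj] V.fin_dim V.dim_is_n by simp
qed

subsection \<open>The algebra of the path\<close>

text \<open>Let g be the gcd and q = (n + 1) / g. As q is coprime to m / g, the condition amounts to
  q dividing s. Since q g = n + 1 already exceeds n, the solutions are q, 2q, ..., (g - 1)
  q.\<close>

lemma card_dvd_multiples:
  fixes n m :: nat
  assumes "1 \<le> m"
  shows "card {s. 1 \<le> s \<and> s \<le> n \<and> (n + 1) dvd s * m} = gcd m (n + 1) - 1"
proof -
  let ?g = "gcd m (n + 1)"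
  define q where "q = (n + 1) div ?g"
  have qg: "q * ?g = n + 1"
    by (simp add: q_def)
  then have q0: "q > 0"
    by (metis add_is_0 mult_0 neq0_conv one_neq_zero)
  have g0: "?g > 0"
    by simp
  have "(n + 1) dvd s * m \<longleftrightarrow> q dvd s" for s
  proof -
    have "coprime q (m div ?g)"
      unfolding q_def using div_gcd_coprime[of m "n + 1"] by (simp add: coprime_commute)
    have "m = ?g * (m div ?g)"
      by simp
    then have "(n + 1) dvd s * m \<longleftrightarrow> ?g * q dvd ?g * (s * (m div ?g))"
      using qg by (metis mult.commute mult.left_commute)
    also have "\<dots> \<longleftrightarrow> q dvd s"
      using g0 \<open>coprime q (m div ?g)\<close> by (simp add: coprime_dvd_mult_left_iff)
    finally show ?thesis .
  qed
  moreover have "q * k \<le> n \<longleftrightarrow> k \<le> ?g - 1" for k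
  proof -
    have "q * k \<le> n \<longleftrightarrow> q * k < q * ?g"
      using qg by linarith
    also have "\<dots> \<longleftrightarrow> k < ?g"
      using q0 by simp
    finally show ?thesis
      using g0 by linarith
  qed
  ultimately have "{s. 1 \<le> s \<and> s \<le> n \<and> (n + 1) dvd s * m} = (\<lambda>k. q * k) ` {1..?g - 1}"
    using q0 by (auto simp: image_iff elim!: dvdE)
  then show ?thesis
    using q0 by (simp add: card_image inj_on_def)
qed

text \<open>Division with remainder: n g = (n + 1)(g - 1) + (n + 1 - g), and the remainder is in
  range because 1 \<le> g \<le> n.\<close>

lemma floor_gcd_fraction:
  fixes n m :: nat
  assumes "1 \<le> m" "m \<le> n"
  shows "\<lfloor>real (n * gcd m (n + 1)) / real (n + 1)\<rfloor> = int (gcd m (n + 1) - 1)"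
proof -
  let ?g = "gcd m (n + 1)"
  have g: "1 \<le> ?g" "?g \<le> n"
    using assms le_trans[OF gcd_le1_nat[of m "n + 1"]] by (simp_all add: Suc_le_eq)
  then obtain k where k: "?g = Suc k" "k < n"
    by (cases ?g) auto
  have "n * ?g div (n + 1) = ?g - 1"
    unfolding k(1) using k(2) by (intro div_nat_eqI) (simp_all add: algebra_simps)
  then show ?thesis
    by (simp only: floor_divide_of_nat_eq)
qed

theorem theorem7p1:
  fixes n m t :: nat
  assumes "n \<ge> 2"
    and "1 \<le> m" and "m \<le> n"
    and "t = card {s :: nat. 1 \<le> s \<and> s \<le> n \<and> (n + 1) dvd s * m}"
  shows "int t = \<lfloor>real (n * gcd m (n + 1)) / real (n + 1)\<rfloor> \<and>
         algebra_isomorphic complex_field (path_algebra_T1 n m)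
           (algebra_sum (matrix_algebra (n - t)) (algebra_Sum {1..t} (\<lambda>_. complex_algebra))) \<and>
         vectorspace.fin_dim complex_field (path_algebra_T1 n m) \<and>
         vectorspace.dim complex_field (path_algebra_T1 n m) = (n - t)\<^sup>2 + t"
proof -
  obtain v where v: "m = Suc v" "v < n"
    using assms(2,3) by (cases m) auto
  let ?U = "sine_matrix n"
  \<comment> \<open>The value 1 beyond the matrix range keeps the zero set of \<open>w\<close>
    inside \<open>{..<n}\<close>, so that its cardinality is the number of zero entries of the
    column.\<close>
  define w where "w i = (if i < n then ?U $$ (i, v) else 1)" for i
  let ?Z = "{i. w i = 0}"
  let ?B = "split_mats n ?Z :: complex mat set"
  have Z: "?Z = {i. i < n \<and> (n + 1) dvd (i + 1) * m}"
    using sine_matrix_eq_0_iff[OF _ v(2)] by (auto simp: w_def v(1))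
  then have Zn: "?Z \<subseteq> {..<n}"
    by auto
  \<comment> \<open>Index i stands for the eigenvector number s = i + 1, so \<open>Suc\<close>
    matches the zeros of the column with the set counted by \<open>t\<close>.\<close>
  have "{s. 1 \<le> s \<and> s \<le> n \<and> (n + 1) dvd s * m} = Suc ` ?Z"
  proof
    show "{s. 1 \<le> s \<and> s \<le> n \<and> (n + 1) dvd s * m} \<subseteq> Suc ` ?Z"
    proof
      fix s assume s: "s \<in> {s. 1 \<le> s \<and> s \<le> n \<and> (n + 1) dvd s * m}"
      then obtain i where "s = Suc i"
        by (cases s) auto
      then show "s \<in> Suc ` ?Z"
        using s unfolding Z by simp
    qed
  qed (auto simp: Z)
  then have cardZ: "card ?Z = t"
    using assms(4) by (simp add: card_image)
  have T: "path_algebra_T1 n m = (matrix_algebra n)\<lparr>carrier := conj_preimage n ?U ?B\<rparr>"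
    unfolding path_algebra_T1_def
  proof (rule generated_subalgebra_eq_conj_preimage)
    show "?U * diagonal_unit n m * ?U = mat n n (\<lambda>(i, j). w i * w j)"
      unfolding v(1) sine_matrix_conj_diagonal_unit[OF v(2)] by (auto simp: w_def)
  qed (use sine_matrix_squared sine_matrix_conj_path_adjacency inj_on_path_eigenvalue in
      \<open>auto simp: path_adjacency_def diagonal_unit_def\<close>)
  have B: "?B \<subseteq> carrier_mat n n"
    by (auto simp: split_mats_def)
  have iso: "(\<lambda>M. ?U * M * ?U) \<in> algebra_iso complex_field (path_algebra_T1 n m)
      ((matrix_algebra n)\<lparr>carrier := ?B\<rparr>)"
    unfolding T by (rule involution_conj_algebra_iso[OF sine_matrix_carrier sine_matrix_squared B])
  \<comment> \<open>The same conjugation is also needed in the opposite direction: the dimension is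
    known for the split matrices, and \<open>algebra_iso_dim\<close> carries it from source to
    target.\<close>
  have "(\<lambda>M. ?U * M * ?U) \<in> algebra_iso complex_field
      ((matrix_algebra n)\<lparr>carrier := conj_preimage n ?U (conj_preimage n ?U ?B)\<rparr>) (path_algebra_T1 n m)"
    unfolding T by (rule involution_conj_algebra_iso[OF sine_matrix_carrier sine_matrix_squared])
      (auto simp: conj_preimage_def)
  then have iso': "(\<lambda>M. ?U * M * ?U) \<in> algebra_iso complex_field
      ((matrix_algebra n)\<lparr>carrier := ?B\<rparr>) (path_algebra_T1 n m)"
    by (simp only: involution_conj_preimage_twice[OF sine_matrix_carrier sine_matrix_squared B])
  have "algebra_isomorphic complex_field (path_algebra_T1 n m)
      (algebra_sum (matrix_algebra (n - t)) (algebra_Sum {1..t} (\<lambda>_. complex_algebra)))"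
    using split_mats_algebra_iso[OF Zn] algebra_iso_trans[OF iso]
    unfolding cardZ algebra_isomorphic_def by blast
  moreover note algebra_iso_dim[OF vectorspace_unital_subalgebra[OF unital_subalgebra_split_mats]
      vectorspace_path_algebra_T1 iso' split_mats_dim(1)[OF Zn]]
  moreover have "int t = \<lfloor>real (n * gcd m (n + 1)) / real (n + 1)\<rfloor>"
    using floor_gcd_fraction[OF assms(2,3)] card_dvd_multiples[OF assms(2)] assms(4) by simp
  ultimately show ?thesis
    using split_mats_dim(2)[OF Zn, where ?'a = complex] cardZ by simp
qed

end
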